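(* Let $G$ be an infinite profinite group. Then $G$ is hereditarily just infinite if and only if $\mathrm{Ob}^*_G(H)$ has finite index for every open subgroup $H$ of $G$.
   Context: All subgroups are closed. A profinite group is just infinite if it is infinite and every non-trivial normal subgroup has finite index; it is hereditarily just infinite if every open subgroup of it (including itself) is just infinite. For a subgroup $H$ of a profinite group $G$, $$\mathrm{Ob}^*_G(H)=H\cap\bigcap\{K\mid K \text{ open subgroup of } G,\ H\le N_G(K),\ K\not\le H\}.$$ *)

theory Defs
  imports "HOL-Analysis.Analysis" "HOL-Algebra.Group_Action"
begin

locale topological_group = group G for G (structure) +
  fixes T
  assumes topspace_eq_carrier: "topspace T = carrier G"
    and continuous_mult: "continuous_map (prod_topology T T) T (\<lambda>(x, y). x \<otimes> y)"
    and continuous_inv: "continuous_map T T (\<lambda>x. inv x)"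

locale profinite_group = topological_group +
  assumes compact: "compact_space T"
    and Hausdorff: "Hausdorff_space T"
    and totally_disconnected: "\<And>x. x \<in> topspace T \<Longrightarrow> connected_component_of_set T x = {x}"

definition open_subgroup :: "'a set \<Rightarrow> ('a, 'b) monoid_scheme \<Rightarrow> 'a topology \<Rightarrow> bool" where
  "open_subgroup H G T \<longleftrightarrow> subgroup H G \<and> openin T H"

definition finite_index :: "'a set \<Rightarrow> ('a, 'b) monoid_scheme \<Rightarrow> bool" where
  "finite_index H G \<longleftrightarrow> finite (rcosets\<^bsub>G\<^esub> H)"

text \<open>Subgroups of profinite groups are understood to be closed, so only closed normal
  subgroups are tested below; open subgroups are closed automatically.\<close>

definition just_infinite :: "('a, 'b) monoid_scheme \<Rightarrow> 'a topology \<Rightarrow> bool" where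
  "just_infinite G T \<longleftrightarrow> infinite (carrier G) \<and>
     (\<forall>N. N \<lhd> G \<and> closedin T N \<and> N \<noteq> {\<one>\<^bsub>G\<^esub>} \<longrightarrow> finite_index N G)"

definition hereditarily_just_infinite :: "('a, 'b) monoid_scheme \<Rightarrow> 'a topology \<Rightarrow> bool" where
  "hereditarily_just_infinite G T \<longleftrightarrow>
     (\<forall>H. open_subgroup H G T \<longrightarrow> just_infinite (G\<lparr>carrier := H\<rparr>) (subtopology T H))"

text \<open>If there is no such \<open>K\<close>, the intersection is \<open>UNIV\<close> and the value is \<open>H\<close>.\<close>

definition Ob_star :: "('a, 'b) monoid_scheme \<Rightarrow> 'a topology \<Rightarrow> 'a set \<Rightarrow> 'a set" where
  "Ob_star G T H =
     H \<inter> \<Inter>{K. open_subgroup K G T \<and> H \<subseteq> normalizer G K \<and> \<not> K \<subseteq> H}"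

end

theory Submission
  imports Defs "HOL-Algebra.Zassenhaus"
begin

text \<open>
  Suppose that \<open>G\<close> is hereditarily just infinite and \<open>H\<close> is open. A nontrivial closed subgroup
  normalized by \<open>H\<close> is normal in its normalizer, which is open, so it is itself open
  (\<open>invariant_closed_subgroup_open\<close>). Let \<open>\<F>\<close> be the family of open subgroups that \<open>H\<close>
  normalizes and that are not contained in \<open>H\<close>. It is enough that \<open>\<F>\<close> is finite
  (\<open>finite_invariant_open_subgroups\<close>), for then \<open>Ob\<^sup>*(H)\<close> is a finite intersection of
  open subgroups.

  The family has no strictly decreasing sequence: by compactness the intersection of such a
  sequence is not contained in \<open>H\<close>, so it is nontrivial and hence open, and by compactness again
  some term is contained in it. If \<open>\<F>\<close> is infinite, there is therefore a minimal member \<open>N\<close> of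
  \<open>\<F>\<close> that has infinitely many members of \<open>\<F>\<close> strictly below it. Then each open subgroup \<open>V\<close>
  has a supplement \<open>K \<in> \<F>\<close> with \<open>K \<subset> N \<subseteq> V K\<close>: shrink \<open>V\<close> to an open normal subgroup \<open>U\<close> of
  \<open>G\<close> inside \<open>N\<close>; if \<open>U K \<noteq> N\<close>, then \<open>U K\<close> is one of the finitely many subgroups between \<open>U\<close> and
  \<open>N\<close> and belongs to \<open>\<F>\<close>, so by minimality of \<open>N\<close> only finitely many \<open>K\<close> lie below it.
  Choosing supplements repeatedly gives proper subgroups \<open>K\<^sub>0, K\<^sub>1, \<dots>\<close> of \<open>N\<close>, each of which
  is a supplement to the intersection of its predecessors. It follows that
  \<open>K\<^sub>0 (K\<^sub>1 \<inter> \<dots> \<inter> K\<^sub>n) = N\<close> for every \<open>n\<close>. By compactness the intersection of \<open>K\<^sub>1, K\<^sub>2, \<dots>\<close> is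
  not contained in \<open>K\<^sub>0\<close>, so it is nontrivial and therefore open. By compactness again it equals
  some \<open>K\<^sub>1 \<inter> \<dots> \<inter> K\<^sub>n\<close>, which is then contained in \<open>K\<^sub>n\<^sub>+\<^sub>1\<close>, so that \<open>K\<^sub>n\<^sub>+\<^sub>1 = N\<close>, a
  contradiction.

  Conversely, let \<open>N \<noteq> 1\<close> be closed and normal in the open subgroup \<open>H\<close>. Choose an open subgroup
  \<open>V \<subseteq> H\<close> that does not contain \<open>N\<close>. For each open normal subgroup \<open>U\<close> of \<open>G\<close>, the open
  subgroup \<open>U N\<close> is normalized by \<open>V\<close> and not contained in \<open>V\<close>, so \<open>Ob\<^sup>*(V) \<subseteq> U N\<close>. The
  intersection of all \<open>U N\<close> is \<open>N\<close>, since the open normal subgroups form a neighbourhood base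
  of the identity. Hence \<open>N\<close> contains \<open>Ob\<^sup>*(V)\<close> and has finite index
  (\<open>Ob_star_subset_normal\<close>).
\<close>

section \<open>Nested closed sets in compact spaces\<close>

lemma compact_space_decseq_subset_open:
  fixes C :: "nat \<Rightarrow> 'a set"
  assumes "compact_space X" and clo: "\<And>n. closedin X (C n)" and "decseq C"
    and V: "openin X V" "(\<Inter>n. C n) \<subseteq> V"
  shows "\<exists>n. C n \<subseteq> V"
proof (rule ccontr)
  assume "\<nexists>n. C n \<subseteq> V"
  then have ne: "C n - V \<noteq> {}" for n by blast
  have "(\<Inter>n. C n - V) \<noteq> {}"
  proof (rule compact_space_imp_nest[OF assms(1)])
    show "closedin X (C n - V)" for n using clo V(1) by blast
    show "decseq (\<lambda>n. C n - V)"
      using \<open>decseq C\<close> unfolding decseq_def by blast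
  qed (use ne in auto)
  then show False using V(2) by auto
qed

section \<open>Normalizers\<close>

context group
begin

lemma mult_inv_cancel:
  assumes "x \<in> carrier G" "y \<in> carrier G"
  shows "x \<otimes> (inv x \<otimes> y) = y" "inv x \<otimes> (x \<otimes> y) = y"
  using assms by (simp_all add: m_assoc[symmetric])

lemma subset_normalizer_iff:
  assumes H: "subgroup H G" and K: "subgroup K G"
  shows "H \<subseteq> normalizer G K \<longleftrightarrow> (\<forall>h\<in>H. \<forall>k\<in>K. h \<otimes> k \<otimes> inv h \<in> K)"
proof -
  note sub = subgroup.subset[OF H] subgroup.subset[OF K]
  have norm: "h \<in> normalizer G K \<longleftrightarrow> (\<lambda>k. h \<otimes> k \<otimes> inv h) ` K = K" if "h \<in> H" for h
  proof -
    have "h <# K #> inv h = (\<lambda>k. h \<otimes> k \<otimes> inv h) ` K"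
      by (auto simp: l_coset_def r_coset_def)
    then show ?thesis using sub that by (auto simp: normalizer_def stabilizer_def)
  qed
  show ?thesis
  proof
    show "\<forall>h\<in>H. \<forall>k\<in>K. h \<otimes> k \<otimes> inv h \<in> K" if "H \<subseteq> normalizer G K"
    proof (intro ballI)
      fix h k assume "h \<in> H" "k \<in> K"
      then show "h \<otimes> k \<otimes> inv h \<in> K" using norm[of h] that by blast
    qed
  next
    assume inv: "\<forall>h\<in>H. \<forall>k\<in>K. h \<otimes> k \<otimes> inv h \<in> K"
    show "H \<subseteq> normalizer G K"
    proof
      fix h assume h: "h \<in> H"
      have "K \<subseteq> (\<lambda>k. h \<otimes> k \<otimes> inv h) ` K"
      proof
        fix k assume k: "k \<in> K"
        have ih: "inv h \<in> H" using H h by (rule subgroup.m_inv_closed)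
        have c: "h \<in> carrier G" "k \<in> carrier G" using h k sub by auto
        then have "inv h \<otimes> k \<otimes> h \<in> K" using inv ih k by (metis inv_inv)
        moreover have "k = h \<otimes> (inv h \<otimes> k \<otimes> h) \<otimes> inv h"
          using c by (simp add: m_assoc mult_inv_cancel)
        ultimately show "k \<in> (\<lambda>k. h \<otimes> k \<otimes> inv h) ` K" by (rule rev_image_eqI)
      qed
      then show "h \<in> normalizer G K" using inv h unfolding norm[OF h] by blast
    qed
  qed
qed

lemma subset_normalizer_Inter:
  assumes H: "subgroup H G" and "\<K> \<noteq> {}"
    and "\<And>K. K \<in> \<K> \<Longrightarrow> subgroup K G \<and> H \<subseteq> normalizer G K"
  shows "H \<subseteq> normalizer G (\<Inter>\<K>)"
proof -
  have "subgroup (\<Inter>\<K>) G" using assms by (intro subgroups_Inter) auto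
  moreover have "h \<otimes> k \<otimes> inv h \<in> K" if "h \<in> H" "k \<in> K" "K \<in> \<K>" for h k K
    using that assms(3)[OF that(3)] subset_normalizer_iff[OF H, of K] by blast
  ultimately show ?thesis unfolding subset_normalizer_iff[OF H \<open>subgroup (\<Inter>\<K>) G\<close>] by blast
qed

lemma subset_normalizer_set_mult:
  assumes H: "subgroup H G" and U: "U \<lhd> G" and K: "subgroup K G" "H \<subseteq> normalizer G K"
  shows "H \<subseteq> normalizer G (U <#> K)"
  unfolding subset_normalizer_iff[OF H mult_norm_subgroup[OF U K(1)]]
proof (intro ballI)
  fix h x assume h: "h \<in> H" and "x \<in> U <#> K"
  then obtain u k where x: "x = u \<otimes> k" "u \<in> U" "k \<in> K" by (auto simp: set_mult_def)
  have c: "h \<in> carrier G" "u \<in> carrier G" "k \<in> carrier G"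
    using h x H K(1) U by (auto dest: subgroup.mem_carrier normal_imp_subgroup)
  have "h \<otimes> u \<otimes> inv h \<in> U" using U x c by (simp add: normal.inv_op_closed2)
  moreover have "h \<otimes> k \<otimes> inv h \<in> K" using K h x subset_normalizer_iff[OF H K(1)] by blast
  moreover have "h \<otimes> x \<otimes> inv h = (h \<otimes> u \<otimes> inv h) \<otimes> (h \<otimes> k \<otimes> inv h)"
    using c by (simp add: x m_assoc mult_inv_cancel)
  ultimately show "h \<otimes> x \<otimes> inv h \<in> U <#> K" by (auto simp: set_mult_def)
qed

lemma normal_subset_normalizer:
  assumes "subgroup H G" "N \<lhd> G\<lparr>carrier := H\<rparr>"
  shows "H \<subseteq> normalizer G N"
  using subgroup.subset[OF normal_imp_subgroup_normalizer[OF assms]] by simp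

lemma set_mult_subset_subgroup:
  assumes "subgroup L G" "A \<subseteq> L" "B \<subseteq> L" shows "A <#> B \<subseteq> L"
proof
  fix x assume "x \<in> A <#> B"
  then obtain a b where "x = a \<otimes> b" "a \<in> A" "b \<in> B" by (auto simp: set_mult_def)
  then show "x \<in> L" using assms subgroup.m_closed[OF assms(1), of a b] by blast
qed

lemma subset_set_mult_left:
  assumes "subgroup U G" "subgroup K G" shows "U \<subseteq> U <#> K"
  using assms subgroup.one_closed[OF assms(2)] subgroup.mem_carrier[OF assms(1)]
  by (force simp: set_mult_def)

lemma subset_set_mult_right:
  assumes "subgroup U G" "subgroup K G" shows "K \<subseteq> U <#> K"
  using assms subgroup.one_closed[OF assms(1)] subgroup.mem_carrier[OF assms(2)]
  by (force simp: set_mult_def)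

end

section \<open>Open subgroups of topological groups\<close>

context topological_group
begin

lemma continuous_map_mult [continuous_intros]:
  assumes "continuous_map X T f" "continuous_map X T g"
  shows "continuous_map X T (\<lambda>x. f x \<otimes> g x)"
proof -
  have "continuous_map X T ((\<lambda>(x, y). x \<otimes> y) \<circ> (\<lambda>x. (f x, g x)))"
    by (rule continuous_map_compose[OF continuous_map_pairedI[OF assms] continuous_mult])
  then show ?thesis by (simp add: o_def)
qed

lemma continuous_map_inv [continuous_intros]:
  assumes "continuous_map X T f"
  shows "continuous_map X T (\<lambda>x. inv (f x))"
  using continuous_map_compose[OF assms continuous_inv] by (simp add: o_def)

lemma r_coset_eq_vimage:
  assumes "A \<subseteq> carrier G" "g \<in> carrier G"
  shows "A #> g = {x \<in> topspace T. x \<otimes> inv g \<in> A}"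
proof -
  have "x \<in> A #> g" if "x \<in> carrier G" "x \<otimes> inv g \<in> A" for x
    unfolding r_coset_def using that assms by (auto intro!: bexI[of _ "x \<otimes> inv g"] simp: m_assoc)
  then show ?thesis
    using assms by (auto simp: r_coset_def topspace_eq_carrier m_assoc subset_iff)
qed

lemma openin_r_coset:
  assumes "openin T A" "g \<in> carrier G" shows "openin T (A #> g)"
proof -
  have "continuous_map T T (\<lambda>x. x \<otimes> inv g)"
    using assms(2) by (intro continuous_intros) (auto simp: topspace_eq_carrier)
  moreover have "A \<subseteq> carrier G"
    using openin_subset[OF assms(1)] by (simp add: topspace_eq_carrier)
  ultimately show ?thesis
    using openin_continuous_map_preimage[OF _ assms(1)] by (simp add: r_coset_eq_vimage assms(2))
qed

lemma closedin_r_coset: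
  assumes "closedin T A" "g \<in> carrier G" shows "closedin T (A #> g)"
proof -
  have "continuous_map T T (\<lambda>x. x \<otimes> inv g)"
    using assms(2) by (intro continuous_intros) (auto simp: topspace_eq_carrier)
  moreover have "A \<subseteq> carrier G"
    using closedin_subset[OF assms(1)] by (simp add: topspace_eq_carrier)
  ultimately show ?thesis
    using closedin_continuous_map_preimage[OF _ assms(1)] by (simp add: r_coset_eq_vimage assms(2))
qed

text \<open>\<open>K\<close> is a union of cosets of \<open>H\<close>.\<close>

lemma open_subgroup_mono:
  assumes H: "open_subgroup H G T" and K: "subgroup K G" "H \<subseteq> K"
  shows "open_subgroup K G T"
proof -
  note sg = H[unfolded open_subgroup_def]
  have "K = (\<Union>k\<in>K. H #> k)"
  proof
    show "K \<subseteq> (\<Union>k\<in>K. H #> k)"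
      using rcos_self[OF _ conjunct1[OF sg]] subgroup.mem_carrier[OF K(1)] by blast
    show "(\<Union>k\<in>K. H #> k) \<subseteq> K"
      using K subgroup.m_closed[OF K(1)] by (auto simp: r_coset_def)
  qed
  moreover have "openin T (\<Union>k\<in>K. H #> k)"
    using sg openin_r_coset subgroup.mem_carrier[OF K(1)] by blast
  ultimately show ?thesis using K by (simp add: open_subgroup_def)
qed

lemma open_subgroup_set_mult:
  assumes "open_subgroup U G T" "U \<lhd> G" "subgroup K G"
  shows "open_subgroup (U <#> K) G T"
  using assms by (intro open_subgroup_mono[OF assms(1)] mult_norm_subgroup subset_set_mult_left)
    (auto simp: open_subgroup_def)

lemma open_subgroup_Int:
  assumes "open_subgroup H G T" "open_subgroup K G T"
  shows "open_subgroup (H \<inter> K) G T"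
  using assms by (auto simp: open_subgroup_def subgroups_Inter_pair)

lemma open_subgroup_carrier: "open_subgroup (carrier G) G T"
  unfolding open_subgroup_def using subgroup_self openin_topspace[of T]
  by (simp add: topspace_eq_carrier)

lemma r_coset_disjoint_subgroup:
  assumes P: "subgroup P G" and x: "x \<in> carrier G" "x \<notin> P"
  shows "(P #> x) \<inter> P = {}"
proof -
  have False if p: "p \<in> P" "p \<otimes> x \<in> P" for p
  proof -
    have "inv p \<otimes> (p \<otimes> x) \<in> P" using p P by (simp add: subgroup.m_closed subgroup.m_inv_closed)
    then show False using x p subgroup.mem_carrier[OF P] by (simp add: m_assoc[symmetric])
  qed
  then show ?thesis by (auto simp: r_coset_def)
qed

lemma subgroup_diff_eq_cosets:
  assumes P: "subgroup P G" and J: "subgroup J G" "P \<subseteq> J"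
  shows "J - P = (\<Union>x\<in>J - P. P #> x)"
proof
  show "J - P \<subseteq> (\<Union>x\<in>J - P. P #> x)"
    using rcos_self[OF _ P] subgroup.mem_carrier[OF J(1)] by blast
  show "(\<Union>x\<in>J - P. P #> x) \<subseteq> J - P"
  proof -
    have "P #> x \<subseteq> J" if "x \<in> J" for x
      using that J subgroup.m_closed[OF J(1)] by (auto simp: r_coset_def)
    then show ?thesis
      using r_coset_disjoint_subgroup[OF P] subgroup.mem_carrier[OF J(1)] by blast
  qed
qed

lemma open_subgroup_imp_closedin:
  assumes "open_subgroup H G T" shows "closedin T H"
proof -
  note sg = assms[unfolded open_subgroup_def]
  have "openin T (carrier G - H)"
    using subgroup_diff_eq_cosets[OF conjunct1[OF sg] subgroup_self subgroup.subset]
      sg openin_r_coset by (metis (no_types, lifting) DiffD1 imageE openin_Union)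
  then show ?thesis
    using sg by (simp add: closedin_def topspace_eq_carrier subgroup.subset)
qed

text \<open>The cosets of \<open>P\<close> in \<open>J\<close> other than \<open>P\<close> form a finite union of closed sets.\<close>

lemma closed_finite_index_imp_open:
  assumes P: "subgroup P G" "closedin T P" and J: "open_subgroup J G T" "P \<subseteq> J"
    and fin: "finite ((\<lambda>x. P #> x) ` J)"
  shows "open_subgroup P G T"
proof -
  have J': "subgroup J G" "openin T J" using J by (auto simp: open_subgroup_def)
  have "closedin T (J - P)"
  proof (subst subgroup_diff_eq_cosets[OF P(1) J'(1) J(2)], rule closedin_Union)
    show "finite ((\<lambda>x. P #> x) ` (J - P))" by (rule finite_subset[OF _ fin]) blast
    show "closedin T S" if "S \<in> (\<lambda>x. P #> x) ` (J - P)" for S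
      using that closedin_r_coset[OF P(2)] subgroup.mem_carrier[OF J'(1)] by blast
  qed
  then have "openin T (J - (J - P))" using J' by blast
  moreover have "J - (J - P) = P" using J by blast
  ultimately show ?thesis using P by (simp add: open_subgroup_def)
qed

end

section \<open>Open normal subgroups of profinite groups\<close>

context profinite_group
begin

text \<open>The cosets of \<open>U\<close> are an open cover by disjoint nonempty sets, so a finite subcover contains
  all of them.\<close>

lemma finite_rcosets_open_subgroup:
  assumes "open_subgroup U G T"
  shows "finite (rcosets U)"
proof -
  have U: "subgroup U G" "openin T U" using assms by (auto simp: open_subgroup_def)
  have "\<forall>V\<in>rcosets U. openin T V" using U openin_r_coset by (auto simp: RCOSETS_def)
  moreover have "\<Union>(rcosets U) = topspace T"
    by (simp add: rcosets_part_G[OF U(1)] topspace_eq_carrier)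
  ultimately obtain \<F> where F: "finite \<F>" "\<F> \<subseteq> rcosets U" "\<Union>\<F> = topspace T"
    using compact unfolding compact_space by meson
  have "rcosets U \<subseteq> \<F>"
  proof
    fix V assume V: "V \<in> rcosets U"
    then have "V \<subseteq> \<Union>\<F>" "V \<noteq> {}"
      using rcosets_part_G[OF U(1)] F(3) subgroup.rcosets_non_empty[OF U(1)]
      by (auto simp: topspace_eq_carrier)
    then obtain W where "W \<in> \<F>" "V \<inter> W \<noteq> {}" by blast
    then show "V \<in> \<F>"
      using rcos_disjoint[OF U(1)] V F(2) by (metis disjnt_def pairwiseD subsetD)
  qed
  then show ?thesis using F(1) finite_subset by blast
qed

text \<open>A subgroup containing \<open>U\<close> is the union of the cosets of \<open>U\<close> that it contains.\<close>

lemma finite_subgroups_above_open: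
  assumes "open_subgroup U G T"
  shows "finite {L. subgroup L G \<and> U \<subseteq> L}"
proof -
  have U: "subgroup U G" using assms by (auto simp: open_subgroup_def)
  have "L \<in> Union ` Pow (rcosets U)" if L: "subgroup L G" "U \<subseteq> L" for L
  proof
    show "L = \<Union>((\<lambda>x. U #> x) ` L)"
    proof
      show "L \<subseteq> \<Union>((\<lambda>x. U #> x) ` L)"
        using rcos_self[OF _ U] subgroup.mem_carrier[OF L(1)] by blast
      show "\<Union>((\<lambda>x. U #> x) ` L) \<subseteq> L"
        using L subgroup.m_closed[OF L(1)] by (auto simp: r_coset_def)
    qed
    show "(\<lambda>x. U #> x) ` L \<in> Pow (rcosets U)"
      using subgroup.mem_carrier[OF L(1)] by (auto simp: RCOSETS_def)
  qed
  then have "{L. subgroup L G \<and> U \<subseteq> L} \<subseteq> Union ` Pow (rcosets U)"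
    by (intro subsetI) simp
  then show ?thesis
    using finite_rcosets_open_subgroup[OF assms] by (meson finite_Pow_iff finite_imageI finite_subset)
qed

text \<open>In a compact Hausdorff space, two closed sets that no connected set meets both of can be
  separated by a clopen set; here all connected sets are singletons or empty.\<close>

lemma clopen_neighbourhood_one:
  assumes "openin T W" "\<one> \<in> W"
  obtains C where "openin T C" "closedin T C" "\<one> \<in> C" "C \<subseteq> W"
proof -
  have one: "\<one> \<in> topspace T" by (simp add: topspace_eq_carrier)
  have "separated_between T {\<one>} (topspace T - W)"
  proof (rule cut_wire_fence_theorem[OF compact Hausdorff])
    fix C assume C: "connectedin T C"
    show "disjnt C {\<one>} \<or> disjnt C (topspace T - W)"
    proof (cases "\<one> \<in> C")
      case True
      then have "C \<subseteq> {\<one>}"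
        using connected_component_of_maximal[OF C True] totally_disconnected[OF one] by simp
      then show ?thesis using assms(2) by (auto simp: disjnt_def)
    qed (auto simp: disjnt_def)
  qed (use assms one Hausdorff in \<open>auto intro: closedin_Hausdorff_singleton\<close>)
  then obtain C where "closedin T C" "openin T C" "{\<one>} \<subseteq> C" "topspace T - W \<subseteq> topspace T - C"
    unfolding separated_between by blast
  then show ?thesis
    using openin_subset[of T C] by (intro that[of C]) blast+
qed

text \<open>Since \<open>T\<close> is compact, the projection of \<open>T \<times> T\<close> to the second factor is closed; the
  complement of the set below is the projection of a closed set.\<close>

lemma openin_forall_compact:
  assumes f: "continuous_map (prod_topology T T) T f" and C: "closedin T C" and V: "openin T V"
  shows "openin T {y \<in> topspace T. \<forall>x\<in>C. f (x, y) \<in> V}" (is "openin T ?Y")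
proof -
  let ?Z = "{z \<in> topspace (prod_topology T T). fst z \<in> C \<and> f z \<in> topspace T - V}"
  have "closedin (prod_topology T T) {z \<in> topspace (prod_topology T T). fst z \<in> C}"
    by (rule closedin_continuous_map_preimage[OF continuous_map_fst C])
  moreover have "closedin (prod_topology T T)
      {z \<in> topspace (prod_topology T T). f z \<in> topspace T - V}"
    using V by (intro closedin_continuous_map_preimage[OF f]) auto
  ultimately have "closedin (prod_topology T T) ({z \<in> topspace (prod_topology T T). fst z \<in> C} \<inter>
      {z \<in> topspace (prod_topology T T). f z \<in> topspace T - V})"
    by (rule closedin_Int)
  also have "\<dots> = ?Z" by blast
  finally have "closedin (prod_topology T T) ?Z" .
  then have "closedin T (snd ` ?Z)"
    using closed_map_snd[OF compact] unfolding closed_map_def by blast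
  then have "openin T (topspace T - snd ` ?Z)" by blast
  moreover have "topspace T - snd ` ?Z = ?Y"
  proof (intro subset_antisym subsetI)
    fix y assume y: "y \<in> ?Y"
    have "y \<notin> snd ` ?Z"
    proof
      assume "y \<in> snd ` ?Z"
      then obtain x where "x \<in> C" "f (x, y) \<notin> V" by auto
      then show False using y by simp
    qed
    then show "y \<in> topspace T - snd ` ?Z" using y by simp
  next
    fix y assume "y \<in> topspace T - snd ` ?Z"
    then have y: "y \<in> topspace T" "y \<notin> snd ` ?Z" by simp_all
    have "f (x, y) \<in> V" if x: "x \<in> C" for x
    proof (rule ccontr)
      assume "f (x, y) \<notin> V"
      moreover have xy: "(x, y) \<in> topspace (prod_topology T T)"
        using x y(1) closedin_subset[OF C] by auto
      moreover have "f (x, y) \<in> topspace T"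
        using continuous_map_funspace[OF f] xy by (rule funcset_mem)
      ultimately have "(x, y) \<in> ?Z" using x by simp
      then have "snd (x, y) \<in> snd ` ?Z" by (rule imageI)
      then show False using y(2) by simp
    qed
    then show "y \<in> ?Y" using y(1) by simp
  qed
  ultimately show ?thesis by simp
qed

text \<open>The elements \<open>g\<close> with \<open>C g = C\<close>, for a clopen neighbourhood \<open>C\<close> of \<open>\<one>\<close>, form an open
  subgroup inside \<open>C\<close>.\<close>

lemma open_subgroup_neighbourhood:
  assumes "openin T W" "\<one> \<in> W"
  obtains S where "open_subgroup S G T" "S \<subseteq> W"
proof -
  obtain C where C: "openin T C" "closedin T C" "\<one> \<in> C" "C \<subseteq> W"
    using clopen_neighbourhood_one[OF assms] .
  have sub: "C \<subseteq> carrier G" using openin_subset[OF C(1)] by (simp add: topspace_eq_carrier)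
  define V where "V = {g \<in> topspace T. \<forall>c\<in>C. c \<otimes> g \<in> C}"
  define S where "S = {g \<in> topspace T. g \<in> V \<and> inv g \<in> V}"
  have "openin T V"
    using openin_forall_compact[OF continuous_mult C(2,1)] by (simp add: V_def)
  then have "openin T {g \<in> topspace T. inv g \<in> V}"
    using openin_continuous_map_preimage[OF continuous_inv] by blast
  then have "openin T (V \<inter> {g \<in> topspace T. inv g \<in> V})"
    using \<open>openin T V\<close> by blast
  moreover have "V \<inter> {g \<in> topspace T. inv g \<in> V} = S" by (auto simp: S_def V_def)
  ultimately have "openin T S" by simp
  have V_mult: "g \<otimes> h \<in> V" if "g \<in> V" "h \<in> V" for g h
    using that sub by (auto simp: V_def topspace_eq_carrier subset_iff m_assoc[symmetric])
  have "subgroup S G"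
  proof (rule subgroupI)
    show "S \<subseteq> carrier G" by (auto simp: S_def topspace_eq_carrier)
    have "\<one> \<in> S" using sub by (auto simp: S_def V_def topspace_eq_carrier)
    then show "S \<noteq> {}" by blast
    show "inv a \<in> S" if "a \<in> S" for a using that by (auto simp: S_def topspace_eq_carrier)
    show "a \<otimes> b \<in> S" if "a \<in> S" "b \<in> S" for a b
      using that V_mult by (auto simp: S_def topspace_eq_carrier inv_mult_group)
  qed
  moreover have "S \<subseteq> W"
  proof
    fix g assume "g \<in> S"
    then have "g \<in> carrier G" "\<one> \<otimes> g \<in> C" using C(3) by (auto simp: S_def V_def topspace_eq_carrier)
    then show "g \<in> W" using C(4) by auto
  qed
  ultimately show ?thesis
    using \<open>openin T S\<close> by (intro that[of S]) (simp_all add: open_subgroup_def)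
qed

text \<open>The normal core of an open subgroup is open, again by projecting along a compact factor.\<close>

lemma open_normal_subgroup_neighbourhood:
  assumes "openin T W" "\<one> \<in> W"
  obtains U where "open_subgroup U G T" "U \<lhd> G" "U \<subseteq> W"
proof -
  obtain S where "open_subgroup S G T" and SW: "S \<subseteq> W"
    using open_subgroup_neighbourhood[OF assms] .
  then have S: "subgroup S G" "openin T S" by (auto simp: open_subgroup_def)
  define U where "U = {g \<in> topspace T. \<forall>x\<in>topspace T. x \<otimes> g \<otimes> inv x \<in> S}"
  have "continuous_map (prod_topology T T) T (\<lambda>z. fst z \<otimes> snd z \<otimes> inv (fst z))"
    by (intro continuous_intros continuous_map_fst continuous_map_snd)
  from openin_forall_compact[OF this closedin_topspace S(2)]
  have "openin T U" by (simp add: U_def)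
  have conj_mult: "x \<otimes> (a \<otimes> b) \<otimes> inv x = (x \<otimes> a \<otimes> inv x) \<otimes> (x \<otimes> b \<otimes> inv x)"
    if "x \<in> carrier G" "a \<in> carrier G" "b \<in> carrier G" for x a b
    using that by (simp add: m_assoc mult_inv_cancel)
  have conj_inv: "x \<otimes> inv a \<otimes> inv x = inv (x \<otimes> a \<otimes> inv x)"
    if "x \<in> carrier G" "a \<in> carrier G" for x a
    using that by (simp add: inv_mult_group m_assoc)
  have "U \<lhd> G"
  proof (rule normal_invI)
    show "subgroup U G"
    proof (rule subgroupI)
      show "U \<subseteq> carrier G" by (auto simp: U_def topspace_eq_carrier)
      have "\<one> \<in> U" using subgroup.one_closed[OF S(1)] by (auto simp: U_def topspace_eq_carrier)
      then show "U \<noteq> {}" by blast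
      show "inv a \<in> U" if "a \<in> U" for a
        using that subgroup.m_inv_closed[OF S(1)] by (auto simp: U_def topspace_eq_carrier conj_inv)
      show "a \<otimes> b \<in> U" if "a \<in> U" "b \<in> U" for a b
        using that subgroup.m_closed[OF S(1)] by (auto simp: U_def topspace_eq_carrier conj_mult)
    qed
    fix x h assume xh: "x \<in> carrier G" "h \<in> U"
    then have h: "h \<in> carrier G" by (simp add: U_def topspace_eq_carrier)
    have "y \<otimes> (x \<otimes> h \<otimes> inv x) \<otimes> inv y = (y \<otimes> x) \<otimes> h \<otimes> inv (y \<otimes> x)" if "y \<in> carrier G" for y
      using that xh h by (simp add: m_assoc inv_mult_group)
    then show "x \<otimes> h \<otimes> inv x \<in> U" using xh h by (auto simp: U_def topspace_eq_carrier)
  qed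
  moreover have "U \<subseteq> S"
  proof
    fix g assume "g \<in> U"
    then have "g \<in> carrier G" and "\<forall>x\<in>carrier G. x \<otimes> g \<otimes> inv x \<in> S"
      by (simp_all add: U_def topspace_eq_carrier)
    then have "g \<in> carrier G" "\<one> \<otimes> g \<otimes> inv \<one> \<in> S" using one_closed by blast+
    then show "g \<in> S" by simp
  qed
  ultimately show ?thesis
    using SW \<open>openin T U\<close>
    by (intro that[of U]) (auto simp: open_subgroup_def intro: normal_imp_subgroup)
qed

end

section \<open>Finiteness of the family of invariant open subgroups\<close>

context profinite_group
begin

text \<open>\<open>P\<close> is normal in its normalizer, which is open because it contains \<open>H\<close>.\<close>

lemma invariant_closed_subgroup_open:
  assumes hji: "hereditarily_just_infinite G T" and H: "open_subgroup H G T"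
    and P: "subgroup P G" "closedin T P" "H \<subseteq> normalizer G P" "P \<noteq> {\<one>}"
  shows "open_subgroup P G T"
proof -
  define J where "J = normalizer G P"
  have J: "open_subgroup J G T"
    unfolding J_def
    by (rule open_subgroup_mono[OF H normalizer_imp_subgroup[OF subgroup.subset[OF P(1)]] P(3)])
  have norm: "P \<lhd> G\<lparr>carrier := J\<rparr>"
    unfolding J_def by (rule subgroup_in_normalizer[OF P(1)])
  have PJ: "P \<subseteq> J"
    using subgroup.subset[OF normal_imp_subgroup[OF norm]] by simp
  have "closedin (subtopology T J) P"
    using P(2) PJ by (simp add: closedin_closed_subset closedin_subset_topspace)
  then have "finite_index P (G\<lparr>carrier := J\<rparr>)"
    using hji J norm P(4) by (simp add: hereditarily_just_infinite_def just_infinite_def)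
  then have "finite ((\<lambda>x. P #> x) ` J)"
    by (simp add: finite_index_def RCOSETS_def UNION_singleton_eq_range)
  then show ?thesis by (rule closed_finite_index_imp_open[OF P(1,2) J PJ])
qed

lemma invariant_open_subgroups_Inter:
  fixes K :: "nat \<Rightarrow> 'a set"
  assumes H: "subgroup H G"
    and K: "\<And>n. open_subgroup (K n) G T" "\<And>n. H \<subseteq> normalizer G (K n)"
  shows "subgroup (\<Inter>n. K n) G" "closedin T (\<Inter>n. K n)" "H \<subseteq> normalizer G (\<Inter>n. K n)"
proof -
  have sg: "subgroup (K n) G" for n using K(1) by (simp add: open_subgroup_def)
  show "subgroup (\<Inter>n. K n) G" using sg by (intro subgroups_Inter) auto
  show "closedin T (\<Inter>n. K n)"
    using K(1) open_subgroup_imp_closedin by (intro closedin_Inter) auto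
  show "H \<subseteq> normalizer G (\<Inter>n. K n)"
    using sg K(2) by (intro subset_normalizer_Inter[OF H]) auto
qed

lemma finite_invariant_open_subgroups:
  assumes hji: "hereditarily_just_infinite G T" and H: "open_subgroup H G T"
  shows "finite {K. open_subgroup K G T \<and> H \<subseteq> normalizer G K \<and> \<not> K \<subseteq> H}"
proof (rule ccontr)
  define \<F> where "\<F> = {K. open_subgroup K G T \<and> H \<subseteq> normalizer G K \<and> \<not> K \<subseteq> H}"
  assume "infinite {K. open_subgroup K G T \<and> H \<subseteq> normalizer G K \<and> \<not> K \<subseteq> H}"
  then have inf: "infinite \<F>" by (simp add: \<F>_def)
  have sgH: "subgroup H G" "openin T H" using H by (auto simp: open_subgroup_def)
  have F_D: "open_subgroup K G T" "H \<subseteq> normalizer G K" "\<not> K \<subseteq> H" if "K \<in> \<F>" for K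
    using that by (simp_all add: \<F>_def)
  have F_I: "K \<in> \<F>" if "open_subgroup K G T" "H \<subseteq> normalizer G K" "\<not> K \<subseteq> H" for K
    using that by (simp add: \<F>_def)
  have F_sub: "subgroup K G" "openin T K" if "K \<in> \<F>" for K
    using F_D(1)[OF that] by (simp_all add: open_subgroup_def)
  have F_carrier: "K \<subseteq> carrier G" if "K \<in> \<F>" for K
    by (rule subgroup.subset[OF F_sub(1)[OF that]])
  have wf: "wf {(A, B). A \<in> \<F> \<and> B \<in> \<F> \<and> A \<subset> B}"
    unfolding wf_iff_no_infinite_down_chain
  proof
    assume "\<exists>f. \<forall>i. (f (Suc i), f i) \<in> {(A, B). A \<in> \<F> \<and> B \<in> \<F> \<and> A \<subset> B}"
    then obtain f where "\<forall>i. (f (Suc i), f i) \<in> {(A, B). A \<in> \<F> \<and> B \<in> \<F> \<and> A \<subset> B}" ..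
    then have f: "f i \<in> \<F>" and less: "f (Suc i) \<subset> f i" for i by simp_all
    have dec: "decseq f" using less by (intro decseq_SucI) (rule psubset_imp_subset)
    have clo: "closedin T (f i)" for i by (rule open_subgroup_imp_closedin[OF F_D(1)[OF f]])
    define P where "P = (\<Inter>i. f i)"
    have P: "subgroup P G" "closedin T P" "H \<subseteq> normalizer G P"
      unfolding P_def using invariant_open_subgroups_Inter[OF sgH(1), of f] F_D(1,2)[OF f] by simp_all
    have "\<not> P \<subseteq> H"
      using compact_space_decseq_subset_open[OF compact clo dec sgH(2)] F_D(3)[OF f]
      unfolding P_def by blast
    then have "P \<noteq> {\<one>}" using subgroup.one_closed[OF sgH(1)] by blast
    then have "openin T P"
      using invariant_closed_subgroup_open[OF hji H P] by (simp add: open_subgroup_def)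
    then obtain n where "f n \<subseteq> P"
      using compact_space_decseq_subset_open[OF compact clo dec] P_def by blast
    then show False using less[of n] unfolding P_def by blast
  qed
  have "carrier G \<in> \<F>"
  proof -
    obtain K where "K \<in> \<F>" using infinite_imp_nonempty[OF inf] by blast
    then have "\<not> carrier G \<subseteq> H" using F_carrier F_D(3) by blast
    moreover have "H \<subseteq> normalizer G (carrier G)"
      unfolding subset_normalizer_iff[OF sgH(1) subgroup_self]
      using subgroup.mem_carrier[OF sgH(1)] by simp
    ultimately show ?thesis by (intro F_I open_subgroup_carrier)
  qed
  moreover have "infinite {K \<in> \<F>. K \<subset> carrier G}"
  proof
    assume "finite {K \<in> \<F>. K \<subset> carrier G}"
    moreover have "\<F> \<subseteq> insert (carrier G) {K \<in> \<F>. K \<subset> carrier G}" using F_carrier by blast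
    ultimately show False using inf finite_subset by blast
  qed
  ultimately obtain N where "N \<in> \<F> \<and> infinite {K \<in> \<F>. K \<subset> N}"
    and wfmin: "\<And>L. (L, N) \<in> {(A, B). A \<in> \<F> \<and> B \<in> \<F> \<and> A \<subset> B} \<Longrightarrow>
      \<not> (L \<in> \<F> \<and> infinite {K \<in> \<F>. K \<subset> L})"
    using wfE_min[OF wf, of "carrier G" "{N. N \<in> \<F> \<and> infinite {K \<in> \<F>. K \<subset> N}}"] by auto
  then have N: "N \<in> \<F>" "infinite {K \<in> \<F>. K \<subset> N}" by simp_all
  have min: "finite {K \<in> \<F>. K \<subset> L}" if "L \<in> \<F>" "L \<subset> N" for L
    using wfmin[of L] that N(1) by simp
  \<comment> \<open>Supplements in \<open>N\<close> to open subgroups \<open>V\<close>. With \<open>U\<close> an open normal subgroup inside \<open>V \<inter> N\<close>,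
    those \<open>K\<close> with \<open>U <#> K \<noteq> N\<close> lie below a member \<open>U <#> K\<close> of the finite set \<open>?bad\<close>, hence in
    the finite set \<open>D\<close>.\<close>
  have supplement: "\<exists>K. K \<in> \<F> \<and> K \<subset> N \<and> N \<subseteq> V <#> K" if V: "open_subgroup V G T" for V
  proof -
    have "openin T (V \<inter> N)" "\<one> \<in> V \<inter> N"
      using V F_sub[OF N(1)] by (auto simp: open_subgroup_def intro: subgroup.one_closed)
    then obtain U where U: "open_subgroup U G T" "U \<lhd> G" "U \<subseteq> V \<inter> N"
      by (rule open_normal_subgroup_neighbourhood)
    have sgU: "subgroup U G" using U by (simp add: open_subgroup_def)
    let ?bad = "{L \<in> \<F>. U \<subseteq> L \<and> L \<subset> N}"
    have "?bad \<subseteq> {L. subgroup L G \<and> U \<subseteq> L}" using F_sub(1) by auto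
    then have fin_bad: "finite ?bad"
      using finite_subgroups_above_open[OF U(1)] finite_subset by blast
    define D where "D = (\<Union>L\<in>?bad. insert L {K \<in> \<F>. K \<subset> L})"
    have "finite D"
      unfolding D_def
    proof (rule finite_UN_I[OF fin_bad])
      show "finite (insert L {K \<in> \<F>. K \<subset> L})" if "L \<in> ?bad" for L
        using min[of L] that by simp
    qed
    then have "\<not> {K \<in> \<F>. K \<subset> N} \<subseteq> D"
      using N(2) finite_subset by blast
    then obtain K where K: "K \<in> \<F>" "K \<subset> N" and "K \<notin> D" by blast
    have nbad: "\<not> K \<subseteq> L" if "L \<in> ?bad" for L
    proof
      assume "K \<subseteq> L"
      then have "K \<in> insert L {K \<in> \<F>. K \<subset> L}" using K(1) by auto
      then show False using \<open>K \<notin> D\<close> that unfolding D_def by (meson UN_I)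
    qed
    note sgK = F_sub(1)[OF K(1)]
    have KUK: "K \<subseteq> U <#> K" and UUK: "U \<subseteq> U <#> K"
      by (rule subset_set_mult_right[OF sgU sgK], rule subset_set_mult_left[OF sgU sgK])
    have "U <#> K \<subseteq> N"
      using U(3) K(2) by (intro set_mult_subset_subgroup[OF F_sub(1)[OF N(1)]]) auto
    moreover have "U <#> K \<in> \<F>"
    proof (rule F_I)
      show "open_subgroup (U <#> K) G T" by (rule open_subgroup_set_mult[OF U(1,2) sgK])
      show "H \<subseteq> normalizer G (U <#> K)"
        by (rule subset_normalizer_set_mult[OF sgH(1) U(2) sgK F_D(2)[OF K(1)]])
      show "\<not> U <#> K \<subseteq> H" using F_D(3)[OF K(1)] KUK by blast
    qed
    ultimately have "U <#> K = N" using nbad[of "U <#> K"] KUK UUK by blast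
    moreover have "U <#> K \<subseteq> V <#> K" using U(3) by (auto simp: set_mult_def)
    ultimately show ?thesis using K by blast
  qed
  then obtain c where c: "\<And>V. open_subgroup V G T \<Longrightarrow> c V \<in> \<F> \<and> c V \<subset> N \<and> N \<subseteq> V <#> c V"
    by metis
  \<comment> \<open>\<open>B n\<close> is \<open>N \<inter> K\<^sub>1 \<inter> \<dots> \<inter> K\<^sub>n\<close>, where the next subgroup \<open>K\<^sub>n\<^sub>+\<^sub>1\<close> is a supplement to
    \<open>K0 \<inter> B n\<close>; this makes \<open>B n\<close> a supplement to \<open>K0\<close> for every \<open>n\<close>.\<close>
  define K0 where "K0 = c (carrier G)"
  define B where "B = rec_nat N (\<lambda>_ A. A \<inter> c (K0 \<inter> A))"
  have B_0: "B 0 = N" and B_Suc: "B (Suc n) = B n \<inter> c (K0 \<inter> B n)" for n by (simp_all add: B_def)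
  have K0: "K0 \<in> \<F>" "K0 \<subset> N" using c[OF open_subgroup_carrier] by (auto simp: K0_def)
  have B_inv: "open_subgroup (B n) G T \<and> H \<subseteq> normalizer G (B n) \<and> B n \<subseteq> N \<and> N \<subseteq> K0 <#> B n"
    for n
  proof (induction n)
    case 0
    have "N \<subseteq> K0 <#> N"
      using subset_set_mult_right F_sub(1) K0(1) N(1) by blast
    then show ?case using F_D(1,2)[OF N(1)] by (simp add: B_0)
  next
    case (Suc n)
    let ?C = "c (K0 \<inter> B n)"
    have "open_subgroup (K0 \<inter> B n) G T"
      using open_subgroup_Int[OF F_D(1)[OF K0(1)]] Suc by blast
    then have C: "?C \<in> \<F>" "?C \<subset> N" "N \<subseteq> (K0 \<inter> B n) <#> ?C" using c by blast+
    have sg: "subgroup (B n) G" "subgroup K0 G" "subgroup ?C G"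
      using Suc F_sub(1)[OF K0(1)] F_sub(1)[OF C(1)] by (simp_all add: open_subgroup_def)
    have "H \<subseteq> normalizer G (\<Inter>{B n, ?C})"
      using Suc F_D(2)[OF C(1)] sg by (intro subset_normalizer_Inter[OF sgH(1)]) auto
    moreover have "N \<subseteq> K0 <#> (B n \<inter> ?C)"
    proof
      fix x assume "x \<in> N"
      then have "x \<in> K0 <#> B n" using Suc by blast
      then obtain k b where x: "x = k \<otimes> b" "k \<in> K0" "b \<in> B n" by (auto simp: set_mult_def)
      \<comment> \<open>Write \<open>b = a d\<close> with \<open>a \<in> K0 \<inter> B n\<close> and \<open>d \<in> ?C\<close>, and move \<open>a\<close> into the factor in \<open>K0\<close>.\<close>
      then have "b \<in> N" using Suc by blast
      then have "b \<in> (K0 \<inter> B n) <#> ?C" using C(3) by blast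
      then obtain a d where b: "b = a \<otimes> d" "a \<in> K0" "a \<in> B n" "d \<in> ?C"
        by (auto simp: set_mult_def)
      have car: "k \<in> carrier G" "a \<in> carrier G" "d \<in> carrier G" "b \<in> carrier G"
        using x b sg by (auto dest: subgroup.mem_carrier)
      have "d = inv a \<otimes> b" using car b(1) by (simp add: mult_inv_cancel)
      moreover have "inv a \<otimes> b \<in> B n"
        using b(3) x(3) by (intro subgroup.m_closed[OF sg(1)] subgroup.m_inv_closed[OF sg(1)])
      ultimately have "d \<in> B n" by simp
      moreover have "x = (k \<otimes> a) \<otimes> d" using x b car by (simp add: m_assoc)
      moreover have "k \<otimes> a \<in> K0" using x b sg(2) by (simp add: subgroup.m_closed)
      ultimately show "x \<in> K0 <#> (B n \<inter> ?C)" using b by (auto simp: set_mult_def)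
    qed
    moreover have "open_subgroup (B n \<inter> ?C) G T"
      using open_subgroup_Int[OF _ F_D(1)[OF C(1)]] Suc by blast
    ultimately show ?case using Suc by (auto simp: B_Suc)
  qed
  have dec: "decseq B" by (intro decseq_SucI) (auto simp: B_Suc)
  have clo: "closedin T (B n)" for n using open_subgroup_imp_closedin B_inv[of n] by simp
  define P where "P = (\<Inter>n. B n)"
  have P: "subgroup P G" "closedin T P" "H \<subseteq> normalizer G P"
    unfolding P_def using invariant_open_subgroups_Inter[OF sgH(1), of B] B_inv by simp_all
  \<comment> \<open>Otherwise \<open>N \<subseteq> K0 <#> B n \<subseteq> K0\<close>.\<close>
  have "\<not> B n \<subseteq> K0" for n
  proof
    assume "B n \<subseteq> K0"
    then have "K0 <#> B n \<subseteq> K0"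
      by (rule set_mult_subset_subgroup[OF F_sub(1)[OF K0(1)] subset_refl])
    then show False using B_inv[of n] K0(2) by blast
  qed
  then have "\<not> P \<subseteq> K0"
    using compact_space_decseq_subset_open[OF compact clo dec F_sub(2)[OF K0(1)]] P_def by blast
  then have "P \<noteq> {\<one>}" using subgroup.one_closed[OF F_sub(1)[OF K0(1)]] by blast
  then have "openin T P"
    using invariant_closed_subgroup_open[OF hji H P] by (simp add: open_subgroup_def)
  then obtain n where "B n \<subseteq> P"
    using compact_space_decseq_subset_open[OF compact clo dec] P_def by blast
  \<comment> \<open>The sequence is now stationary from \<open>n\<close> on, so the supplement to \<open>K0 \<inter> B n\<close> contains
    \<open>K0 \<inter> B n\<close> and cannot be proper.\<close>
  let ?C = "c (K0 \<inter> B n)"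
  have "open_subgroup (K0 \<inter> B n) G T"
    using open_subgroup_Int[OF F_D(1)[OF K0(1)]] B_inv[of n] by simp
  then have C: "?C \<in> \<F>" "?C \<subset> N" "N \<subseteq> (K0 \<inter> B n) <#> ?C" using c by blast+
  have "B n \<subseteq> B (Suc n)" using \<open>B n \<subseteq> P\<close> by (auto simp: P_def)
  then have "K0 \<inter> B n \<subseteq> ?C" by (auto simp: B_Suc)
  then have "(K0 \<inter> B n) <#> ?C \<subseteq> ?C"
    by (rule set_mult_subset_subgroup[OF F_sub(1)[OF C(1)] _ subset_refl])
  then show False using C by blast
qed

lemma finite_index_Ob_star:
  assumes hji: "hereditarily_just_infinite G T" and H: "open_subgroup H G T"
  shows "finite_index (Ob_star G T H) G"
proof -
  let ?\<F> = "{K. open_subgroup K G T \<and> H \<subseteq> normalizer G K \<and> \<not> K \<subseteq> H}"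
  have eq: "Ob_star G T H = \<Inter>(insert H ?\<F>)" by (simp add: Ob_star_def)
  have "subgroup (Ob_star G T H) G"
    unfolding eq using H by (intro subgroups_Inter) (auto simp: open_subgroup_def)
  moreover have "openin T (Ob_star G T H)"
    unfolding eq using H finite_invariant_open_subgroups[OF hji H]
    by (intro openin_Inter) (auto simp: open_subgroup_def)
  ultimately have "open_subgroup (Ob_star G T H) G T" by (simp add: open_subgroup_def)
  then show ?thesis
    unfolding finite_index_def by (rule finite_rcosets_open_subgroup)
qed

section \<open>Recovering the just infinite property\<close>

lemma infinite_open_subgroup:
  assumes "infinite (carrier G)" "open_subgroup H G T"
  shows "infinite H"
proof
  assume "finite H"
  have H: "subgroup H G" using assms by (simp add: open_subgroup_def)
  have "finite (\<Union>(rcosets H))"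
    using finite_rcosets_open_subgroup[OF assms(2)]
      rcosets_finite[OF _ subgroup.subset[OF H] \<open>finite H\<close>] by blast
  then show False using assms(1) rcosets_part_G[OF H] by simp
qed

text \<open>Here \<open>A\<close> need not be a subgroup: the map \<open>C \<mapsto> N C\<close> sends \<open>A g\<close> to \<open>N g\<close>.\<close>

lemma finite_rcosets_mono:
  assumes N: "subgroup N G" and A: "A \<subseteq> N" "\<one> \<in> A" and fin: "finite (rcosets A)"
  shows "finite (rcosets N)"
proof -
  have "N <#> (A #> g) = N #> g" if "g \<in> carrier G" for g
  proof -
    have "N <#> (A #> g) = (N <#> A) #> g"
      using that A subgroup.subset[OF N] by (simp add: setmult_rcos_assoc subset_trans)
    moreover have "N <#> A = N"
    proof
      show "N <#> A \<subseteq> N" by (rule set_mult_subset_subgroup[OF N subset_refl A(1)])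
      show "N \<subseteq> N <#> A"
        using A(2) subgroup.mem_carrier[OF N] by (force simp: set_mult_def)
    qed
    ultimately show ?thesis by simp
  qed
  then have "rcosets N \<subseteq> (\<lambda>C. N <#> C) ` (rcosets A)" by (force simp: RCOSETS_def)
  then show ?thesis using fin by (meson finite_imageI finite_subset)
qed

text \<open>If \<open>y \<notin> N\<close>, then \<open>N\<close> being closed gives an open normal subgroup \<open>U\<close> with \<open>y \<notin> U N\<close>, and
  \<open>U N\<close> is one of the subgroups in the definition of \<open>Ob\<^sup>*(V)\<close>.\<close>

lemma Ob_star_subset_normal:
  assumes H: "open_subgroup H G T" and N: "N \<lhd> G\<lparr>carrier := H\<rparr>" "closedin T N"
    and V: "open_subgroup V G T" "V \<subseteq> H" "\<not> N \<subseteq> V"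
  shows "Ob_star G T V \<subseteq> N"
proof
  fix y assume y: "y \<in> Ob_star G T V"
  have sgH: "subgroup H G" and sgV: "subgroup V G" using H V by (auto simp: open_subgroup_def)
  have sgN: "subgroup N G"
    using incl_subgroup[OF sgH normal_imp_subgroup[OF N(1)]] .
  have y': "y \<in> carrier G" using y subgroup.mem_carrier[OF sgV] by (simp add: Ob_star_def)
  show "y \<in> N"
  proof (rule ccontr)
    assume "y \<notin> N"
    define W where "W = {u \<in> topspace T. inv u \<otimes> y \<in> topspace T - N}"
    have "continuous_map T T (\<lambda>u. inv u \<otimes> y)"
      using y' by (intro continuous_intros) (auto simp: topspace_eq_carrier)
    then have "openin T W"
      unfolding W_def using N(2) by (intro openin_continuous_map_preimage) auto
    moreover have "\<one> \<in> W" using y' \<open>y \<notin> N\<close> by (simp add: W_def topspace_eq_carrier)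
    ultimately obtain U where U: "open_subgroup U G T" "U \<lhd> G" "U \<subseteq> W"
      by (rule open_normal_subgroup_neighbourhood)
    have sgU: "subgroup U G" using U by (simp add: open_subgroup_def)
    have "H \<subseteq> normalizer G (U <#> N)"
      by (rule subset_normalizer_set_mult[OF sgH U(2) sgN normal_subset_normalizer[OF sgH N(1)]])
    then have "V \<subseteq> normalizer G (U <#> N)" using V(2) by blast
    moreover have "\<not> U <#> N \<subseteq> V" using subset_set_mult_right[OF sgU sgN] V(3) by blast
    ultimately have "y \<in> U <#> N"
      using y open_subgroup_set_mult[OF U(1,2) sgN] by (auto simp: Ob_star_def)
    then obtain u n where un: "y = u \<otimes> n" "u \<in> U" "n \<in> N" by (auto simp: set_mult_def)
    then have "inv u \<otimes> y = n"
      using subgroup.mem_carrier[OF sgU] subgroup.mem_carrier[OF sgN] by (simp add: mult_inv_cancel)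
    then show False using un U(3) by (auto simp: W_def)
  qed
qed

lemma just_infinite_open_subgroup:
  assumes inf: "infinite (carrier G)" and H: "open_subgroup H G T"
    and Ob: "\<And>V. open_subgroup V G T \<Longrightarrow> finite_index (Ob_star G T V) G"
  shows "just_infinite (G\<lparr>carrier := H\<rparr>) (subtopology T H)"
  unfolding just_infinite_def
proof (intro conjI allI impI)
  show "infinite (carrier (G\<lparr>carrier := H\<rparr>))" using infinite_open_subgroup[OF inf H] by simp
  fix N assume "N \<lhd> G\<lparr>carrier := H\<rparr> \<and> closedin (subtopology T H) N \<and> N \<noteq> {\<one>\<^bsub>G\<lparr>carrier := H\<rparr>\<^esub>}"
  then have N: "N \<lhd> G\<lparr>carrier := H\<rparr>" "closedin (subtopology T H) N" "N \<noteq> {\<one>}" by auto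
  have sgH: "subgroup H G" "openin T H" using H by (auto simp: open_subgroup_def)
  have cloN: "closedin T N" using closedin_trans_full[OF N(2) open_subgroup_imp_closedin[OF H]] .
  have sgN: "subgroup N G"
    using incl_subgroup[OF sgH(1) normal_imp_subgroup[OF N(1)]] .
  obtain x where x: "x \<in> N" "x \<noteq> \<one>" using N(3) subgroup.one_closed[OF sgN] by blast
  have "closedin T {x}"
    using x subgroup.mem_carrier[OF sgN] Hausdorff
    by (simp add: closedin_Hausdorff_singleton topspace_eq_carrier)
  then have "openin T (H - {x})" "\<one> \<in> H - {x}"
    using sgH x subgroup.one_closed[OF sgH(1)] by auto
  then obtain V where V: "open_subgroup V G T" "V \<subseteq> H - {x}"
    by (rule open_subgroup_neighbourhood)
  have sgV: "subgroup V G" using V by (simp add: open_subgroup_def)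
  have "Ob_star G T V \<subseteq> N"
    using V x by (intro Ob_star_subset_normal[OF H N(1) cloN V(1)]) auto
  moreover have "\<one> \<in> Ob_star G T V"
    using subgroup.one_closed[OF sgV] by (auto simp: Ob_star_def open_subgroup_def subgroup.one_closed)
  ultimately have "finite (rcosets N)"
    using finite_rcosets_mono[OF sgN] Ob[OF V(1)] by (simp add: finite_index_def)
  moreover have "rcosets\<^bsub>G\<lparr>carrier := H\<rparr>\<^esub> N \<subseteq> rcosets N"
    using subgroup.mem_carrier[OF sgH(1)] by (auto simp: RCOSETS_def)
  ultimately show "finite_index N (G\<lparr>carrier := H\<rparr>)"
    unfolding finite_index_def by (rule rev_finite_subset)
qed

end

theorem corollary2p7:
  fixes G :: "('a, 'b) monoid_scheme" and T :: "'a topology"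
  assumes "profinite_group G T" and "infinite (carrier G)"
  shows "hereditarily_just_infinite G T \<longleftrightarrow>
    (\<forall>H. open_subgroup H G T \<longrightarrow> finite_index (Ob_star G T H) G)"
proof -
  interpret profinite_group G T by (rule assms(1))
  show ?thesis
    using finite_index_Ob_star just_infinite_open_subgroup[OF assms(2)]
    by (auto simp: hereditarily_just_infinite_def)
qed

end
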